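(* Let $F:(M,g_M,J)\to(B,g_B)$ be a generic Riemannian submersion from a nearly Kaehler manifold onto a Riemannian manifold. Then the distribution $\mathcal{D}$ is integrable if and only if $$\mathcal{V}\nabla_{U}\phi V-\mathcal{V}\nabla_{V}\phi U-2\mathcal{Q}_{U}V\in\Gamma(\mathcal{D})\quad\text{and}\quad \mathcal{T}_{U}\phi V-\mathcal{T}_{V}\phi U-2\mathcal{P}_{U}V\in\Gamma(\mu)$$ for any $U,V\in\Gamma(\mathcal{D})$.
   Context: An almost Hermitian manifold $(M,g_M,J)$ is a Riemannian manifold with an almost complex structure $J$ such that $J^2=-I$ and $g_M(JX,JY)=g_M(X,Y)$; $\nabla$ is the Levi-Civita connection of $g_M$. It is nearly Kaehler if $(\nabla_XJ)Y+(\nabla_YJ)X=0$ for all $X,Y$. A Riemannian submersion $F:(M,g_M)\to(B,g_B)$ (with $\dim M>\dim B$) is a smooth map of maximal rank whose differential $F_*$ preserves the scalar product of vectors normal to the fibers. $\ker F_*$ is the vertical distribution, its orthogonal complement $(\ker F_* )^\perp$ the horizontal distribution; $\mathcal{V},\mathcal{H}$ denote the orthogonal projections of $TM$ onto them. $F$ is a generic Riemannian submersion if there is a distribution $\mathcal{D}\subset\ker F_*$ with $\ker F_*=\mathcal{D}\oplus\mathcal{D}^\perp$ and $J\mathcal{D}=\mathcal{D}$, where $\mathcal{D}^\perp$ is the orthogonal complement of $\mathcal{D}$ in $\ker F_*$ and is purely real, i.e. $\mathcal{D}^\perp\cap J\mathcal{D}^\perp=\{0\}$. For vertical $U$ write $JU=\phi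 U+\omega U$ with $\phi U$ vertical and $\omega U$ horizontal. $\mu$ is the orthogonal complement of $\omega\mathcal{D}^\perp$ in $(\ker F_* )^\perp$. O'Neill's tensor: $\mathcal{T}_{E}G=\mathcal{H}\nabla_{\mathcal{V}E}\mathcal{V}G+\mathcal{V}\nabla_{\mathcal{V}E}\mathcal{H}G$ for vector fields $E,G$ on $M$. $\mathcal{P}_{E}G$ and $\mathcal{Q}_{E}G$ denote respectively the horizontal and vertical parts of $(\nabla_EJ)G$. *)

theory Defs
  imports "HOL-Analysis.Analysis" "HOL-Library.Function_Algebras"
begin

text \<open>
  Real-valued functions form a real vector space under the pointwise operations; tangent vectors
  (functionals on functions) and vector fields inherit their linear structure from this instance.
\<close>

instantiation "fun" :: (type, real_vector) real_vector
begin

definition scaleR_fun :: "real \<Rightarrow> ('a \<Rightarrow> 'b) \<Rightarrow> 'a \<Rightarrow> 'b"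
  where "scaleR_fun c f = (\<lambda>x. c *\<^sub>R f x)"

instance
  by standard (auto simp: scaleR_fun_def plus_fun_def fun_eq_iff scaleR_add_right scaleR_add_left)

end

section \<open>Smooth manifolds\<close>

text \<open>For open \<open>S\<close> in a finite-dimensional space, \<open>Ck_on k f S\<close> says that \<open>f\<close> is of class \<open>C^k\<close> on \<open>S\<close>.\<close>

fun Ck_on :: "nat \<Rightarrow> ('e::real_normed_vector \<Rightarrow> 'f::real_normed_vector) \<Rightarrow> 'e set \<Rightarrow> bool" where
  "Ck_on 0 f S \<longleftrightarrow> continuous_on S f"
| "Ck_on (Suc k) f S \<longleftrightarrow>
     (\<forall>x\<in>S. f differentiable (at x)) \<and> (\<forall>v. Ck_on k (\<lambda>x. frechet_derivative f (at x) v) S)"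

definition smooth_on :: "('e::real_normed_vector \<Rightarrow> 'f::real_normed_vector) \<Rightarrow> 'e set \<Rightarrow> bool"
  where "smooth_on f S \<longleftrightarrow> (\<forall>k. Ck_on k f S)"

type_synonym ('m, 'e) atlas = "('m set \<times> ('m \<Rightarrow> 'e)) set"

text \<open>
  The manifold is the whole Hausdorff, second countable type \<open>'m\<close>. Charts take values in the
  finite-dimensional space \<open>'e\<close>, so the dimension of the manifold is \<open>dim (UNIV :: 'e set)\<close>; the
  class \<open>real_normed_vector\<close> is used instead of \<open>euclidean_space\<close> only because the latter excludes
  dimension 0.
\<close>

definition smooth_atlas ::
  "('m::{t2_space,second_countable_topology}, 'e::real_normed_vector) atlas \<Rightarrow> bool" where
  "smooth_atlas A \<longleftrightarrow>
     (\<exists>S. finite S \<and> span S = (UNIV :: 'e set)) \<and>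
     (\<Union>(fst ` A)) = UNIV \<and>
     (\<forall>(U, \<phi>)\<in>A. open U \<and> open (\<phi> ` U) \<and> homeomorphism U (\<phi> ` U) \<phi> (inv_into U \<phi>)) \<and>
     (\<forall>(U, \<phi>)\<in>A. \<forall>(V, \<psi>)\<in>A. smooth_on (\<psi> \<circ> inv_into U \<phi>) (\<phi> ` (U \<inter> V)))"

definition smooth_funs :: "('m, 'e::real_normed_vector) atlas \<Rightarrow> ('m \<Rightarrow> real) set" where
  "smooth_funs A = {f. \<forall>(U, \<phi>)\<in>A. smooth_on (f \<circ> inv_into U \<phi>) (\<phi> ` U)}"

definition smooth_map ::
  "('m::topological_space, 'e::real_normed_vector) atlas \<Rightarrow>
   ('b::topological_space, 'f::real_normed_vector) atlas \<Rightarrow> ('m \<Rightarrow> 'b) \<Rightarrow> bool" where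
  "smooth_map A B F \<longleftrightarrow> continuous_on UNIV F \<and>
     (\<forall>(U, \<phi>)\<in>A. \<forall>(V, \<psi>)\<in>B. smooth_on (\<psi> \<circ> F \<circ> inv_into U \<phi>) (\<phi> ` (U \<inter> F -` V)))"

text \<open>
  Tangent vectors at \<open>p\<close> are the directional derivatives of smooth functions at \<open>p\<close>, i.e. the
  operators \<open>\<Sum>i. w\<^sub>i \<partial>/\<partial>x\<^sub>i\<close> in a chart around \<open>p\<close>. They are made to vanish on non-smooth
  functions so that equality of tangent vectors is equality of HOL functions.
\<close>

type_synonym 'm tvec = "('m \<Rightarrow> real) \<Rightarrow> real"
type_synonym 'm vfield = "'m \<Rightarrow> 'm tvec"
type_synonym 'm metric = "'m \<Rightarrow> 'm tvec \<Rightarrow> 'm tvec \<Rightarrow> real"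
type_synonym 'm connection = "'m vfield \<Rightarrow> 'm vfield \<Rightarrow> 'm vfield"

definition chart_vec ::
  "('m, 'e::real_normed_vector) atlas \<Rightarrow> 'm set \<Rightarrow> ('m \<Rightarrow> 'e) \<Rightarrow> 'm \<Rightarrow> 'e \<Rightarrow> 'm tvec" where
  "chart_vec A U \<phi> p w =
     (\<lambda>f. if f \<in> smooth_funs A then frechet_derivative (f \<circ> inv_into U \<phi>) (at (\<phi> p)) w else 0)"

definition tangent_space :: "('m, 'e::real_normed_vector) atlas \<Rightarrow> 'm \<Rightarrow> 'm tvec set" where
  "tangent_space A p = {chart_vec A U \<phi> p w | U \<phi> w. (U, \<phi>) \<in> A \<and> p \<in> U}"

definition vector_fields :: "('m, 'e::real_normed_vector) atlas \<Rightarrow> 'm vfield set" where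
  "vector_fields A =
     {X. (\<forall>p. X p \<in> tangent_space A p) \<and> (\<forall>f\<in>smooth_funs A. (\<lambda>p. X p f) \<in> smooth_funs A)}"

definition fun_smult :: "('m \<Rightarrow> real) \<Rightarrow> 'm vfield \<Rightarrow> 'm vfield" where
  "fun_smult f X = (\<lambda>p. f p *\<^sub>R X p)"

definition lie_bracket :: "'m vfield \<Rightarrow> 'm vfield \<Rightarrow> 'm vfield" where
  "lie_bracket X Y = (\<lambda>p f. X p (\<lambda>q. Y q f) - Y p (\<lambda>q. X q f))"

text \<open>The guard on \<open>h\<close> matches the convention that tangent vectors vanish on non-smooth functions.\<close>

definition differential ::
  "('b, 'f::real_normed_vector) atlas \<Rightarrow> ('m \<Rightarrow> 'b) \<Rightarrow> 'm tvec \<Rightarrow> 'b tvec" where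
  "differential B F v = (\<lambda>h. if h \<in> smooth_funs B then v (h \<circ> F) else 0)"

section \<open>Distributions\<close>

text \<open>
  A smooth subbundle of constant rank \<open>k\<close>. The local frame may be taken to consist of global
  fields that span \<open>D q\<close> only for \<open>q\<close> in \<open>N\<close>:
  a frame defined near \<open>p\<close> can be cut off by a bump function.
\<close>

definition distribution ::
  "('m::topological_space, 'e::real_normed_vector) atlas \<Rightarrow> ('m \<Rightarrow> 'm tvec set) \<Rightarrow> bool" where
  "distribution A D \<longleftrightarrow>
     (\<exists>k::nat. \<forall>p. \<exists>N X. open N \<and> p \<in> N \<and> (\<forall>i<k. X i \<in> vector_fields A) \<and>
        (\<forall>q\<in>N. inj_on (\<lambda>i. X i q) {..<k} \<and> independent ((\<lambda>i. X i q) ` {..<k}) \<and>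
               span ((\<lambda>i. X i q) ` {..<k}) = D q))"

definition sections ::
  "('m, 'e::real_normed_vector) atlas \<Rightarrow> ('m \<Rightarrow> 'm tvec set) \<Rightarrow> 'm vfield set" where
  "sections A D = {X \<in> vector_fields A. \<forall>p. X p \<in> D p}"

text \<open>
  Integrability is understood, as is customary for Riemannian submersions, as closure of the
  smooth sections of \<open>D\<close> under the Lie bracket.
\<close>

definition integrable_distribution ::
  "('m, 'e::real_normed_vector) atlas \<Rightarrow> ('m \<Rightarrow> 'm tvec set) \<Rightarrow> bool" where
  "integrable_distribution A D \<longleftrightarrow>
     (\<forall>X\<in>sections A D. \<forall>Y\<in>sections A D. lie_bracket X Y \<in> sections A D)"

section \<open>Riemannian and nearly Kaehler manifolds\<close>

definition riemannian_manifold ::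
  "('m::{t2_space,second_countable_topology}, 'e::real_normed_vector) atlas \<Rightarrow> 'm metric \<Rightarrow> bool"
where
  "riemannian_manifold A g \<longleftrightarrow> smooth_atlas A \<and>
     (\<forall>p. \<forall>u\<in>tangent_space A p. \<forall>v\<in>tangent_space A p.
        g p u v = g p v u \<and> (u \<noteq> 0 \<longrightarrow> g p u u > 0) \<and>
        (\<forall>c. g p (c *\<^sub>R u) v = c * g p u v) \<and>
        (\<forall>w\<in>tangent_space A p. g p (u + w) v = g p u v + g p w v)) \<and>
     (\<forall>X\<in>vector_fields A. \<forall>Y\<in>vector_fields A. (\<lambda>p. g p (X p) (Y p)) \<in> smooth_funs A)"

text \<open>
  The Levi-Civita connection, as an operator on smooth vector fields (its values on other
  arguments are irrelevant): the torsion-free metric connection.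
\<close>

definition levi_civita ::
  "('m, 'e::real_normed_vector) atlas \<Rightarrow> 'm metric \<Rightarrow> 'm connection \<Rightarrow> bool" where
  "levi_civita A g nabla \<longleftrightarrow>
     (\<forall>X\<in>vector_fields A. \<forall>Y\<in>vector_fields A.
        nabla X Y \<in> vector_fields A \<and>
        nabla X Y - nabla Y X = lie_bracket X Y \<and>
        (\<forall>f\<in>smooth_funs A.
           nabla (fun_smult f X) Y = fun_smult f (nabla X Y) \<and>
           nabla X (fun_smult f Y) = fun_smult (\<lambda>p. X p f) Y + fun_smult f (nabla X Y)) \<and>
        (\<forall>Z\<in>vector_fields A.
           nabla (X + Y) Z = nabla X Z + nabla Y Z \<and>
           nabla X (Y + Z) = nabla X Y + nabla X Z \<and>
           (\<forall>p. X p (\<lambda>q. g q (Y q) (Z q)) = g p (nabla X Y p) (Z p) + g p (Y p) (nabla X Z p))))"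

definition almost_hermitian ::
  "('m::{t2_space,second_countable_topology}, 'e::real_normed_vector) atlas \<Rightarrow> 'm metric \<Rightarrow>
   ('m \<Rightarrow> 'm tvec \<Rightarrow> 'm tvec) \<Rightarrow> bool" where
  "almost_hermitian A g J \<longleftrightarrow> riemannian_manifold A g \<and>
     (\<forall>p. \<forall>u\<in>tangent_space A p.
        J p u \<in> tangent_space A p \<and> J p (J p u) = - u \<and>
        (\<forall>c. J p (c *\<^sub>R u) = c *\<^sub>R J p u) \<and>
        (\<forall>v\<in>tangent_space A p. J p (u + v) = J p u + J p v \<and> g p (J p u) (J p v) = g p u v)) \<and>
     (\<forall>X\<in>vector_fields A. (\<lambda>p. J p (X p)) \<in> vector_fields A)"

text \<open>\<open>nablaJ nabla J X Y\<close> is \<open>(\<nabla>\<^sub>X J) Y = \<nabla>\<^sub>X (J Y) - J (\<nabla>\<^sub>X Y)\<close>.\<close>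

definition nablaJ :: "'m connection \<Rightarrow> ('m \<Rightarrow> 'm tvec \<Rightarrow> 'm tvec) \<Rightarrow> 'm connection" where
  "nablaJ nabla J X Y = (\<lambda>p. nabla X (\<lambda>q. J q (Y q)) p - J p (nabla X Y p))"

definition nearly_kaehler ::
  "('m::{t2_space,second_countable_topology}, 'e::real_normed_vector) atlas \<Rightarrow> 'm metric \<Rightarrow>
   ('m \<Rightarrow> 'm tvec \<Rightarrow> 'm tvec) \<Rightarrow> 'm connection \<Rightarrow> bool" where
  "nearly_kaehler A g J nabla \<longleftrightarrow> almost_hermitian A g J \<and> levi_civita A g nabla \<and>
     (\<forall>X\<in>vector_fields A. \<forall>Y\<in>vector_fields A. nablaJ nabla J X Y + nablaJ nabla J Y X = 0)"

section \<open>Generic Riemannian submersions\<close>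

text \<open>Below, \<open>A\<close> and \<open>B\<close> are atlases of the total space and the base, \<open>F\<close> is the submersion.\<close>

definition vertical ::
  "('m, 'e::real_normed_vector) atlas \<Rightarrow> ('b, 'f::real_normed_vector) atlas \<Rightarrow> ('m \<Rightarrow> 'b) \<Rightarrow>
   'm \<Rightarrow> 'm tvec set" where
  "vertical A B F p = {v \<in> tangent_space A p. differential B F v = 0}"

definition orth_compl_in ::
  "'m metric \<Rightarrow> 'm \<Rightarrow> 'm tvec set \<Rightarrow> 'm tvec set \<Rightarrow> 'm tvec set" where
  "orth_compl_in g p W S = {v \<in> W. \<forall>u\<in>S. g p v u = 0}"

definition horizontal ::
  "('m, 'e::real_normed_vector) atlas \<Rightarrow> 'm metric \<Rightarrow> ('b, 'f::real_normed_vector) atlas \<Rightarrow>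
   ('m \<Rightarrow> 'b) \<Rightarrow> 'm \<Rightarrow> 'm tvec set" where
  "horizontal A g B F p = orth_compl_in g p (tangent_space A p) (vertical A B F p)"

definition riemannian_submersion ::
  "('m::{t2_space,second_countable_topology}, 'e::real_normed_vector) atlas \<Rightarrow> 'm metric \<Rightarrow>
   ('b::{t2_space,second_countable_topology}, 'f::real_normed_vector) atlas \<Rightarrow> 'b metric \<Rightarrow>
   ('m \<Rightarrow> 'b) \<Rightarrow> bool" where
  "riemannian_submersion A g B gB F \<longleftrightarrow>
     riemannian_manifold A g \<and> riemannian_manifold B gB \<and>
     dim (UNIV :: 'f set) < dim (UNIV :: 'e set) \<and>
     smooth_map A B F \<and> surj F \<and>
     (\<forall>p. differential B F ` tangent_space A p = tangent_space B (F p)) \<and>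
     (\<forall>p. \<forall>u\<in>horizontal A g B F p. \<forall>v\<in>horizontal A g B F p.
        gB (F p) (differential B F u) (differential B F v) = g p u v)"

text \<open>The orthogonal complement of \<open>D\<close> in the vertical distribution.\<close>

definition D_perp ::
  "('m, 'e::real_normed_vector) atlas \<Rightarrow> 'm metric \<Rightarrow> ('b, 'f::real_normed_vector) atlas \<Rightarrow>
   ('m \<Rightarrow> 'b) \<Rightarrow> ('m \<Rightarrow> 'm tvec set) \<Rightarrow> 'm \<Rightarrow> 'm tvec set" where
  "D_perp A g B F D p = orth_compl_in g p (vertical A B F p) (D p)"

definition generic_riemannian_submersion ::
  "('m::{t2_space,second_countable_topology}, 'e::real_normed_vector) atlas \<Rightarrow> 'm metric \<Rightarrow>
   ('m \<Rightarrow> 'm tvec \<Rightarrow> 'm tvec) \<Rightarrow>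
   ('b::{t2_space,second_countable_topology}, 'f::real_normed_vector) atlas \<Rightarrow> 'b metric \<Rightarrow>
   ('m \<Rightarrow> 'b) \<Rightarrow> ('m \<Rightarrow> 'm tvec set) \<Rightarrow> bool" where
  "generic_riemannian_submersion A g J B gB F D \<longleftrightarrow>
     riemannian_submersion A g B gB F \<and> distribution A D \<and>
     (\<forall>p. D p \<subseteq> vertical A B F p \<and>
          vertical A B F p = {u + v | u v. u \<in> D p \<and> v \<in> D_perp A g B F D p} \<and>
          D p \<inter> D_perp A g B F D p = {0} \<and>
          J p ` D p = D p \<and>
          D_perp A g B F D p \<inter> J p ` D_perp A g B F D p = {0})"

definition orth_proj :: "'m metric \<Rightarrow> 'm \<Rightarrow> 'm tvec set \<Rightarrow> 'm tvec \<Rightarrow> 'm tvec" where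
  "orth_proj g p S v = (THE u. u \<in> S \<and> (\<forall>w\<in>S. g p (v - u) w = 0))"

definition vert ::
  "('m, 'e::real_normed_vector) atlas \<Rightarrow> 'm metric \<Rightarrow> ('b, 'f::real_normed_vector) atlas \<Rightarrow>
   ('m \<Rightarrow> 'b) \<Rightarrow> 'm vfield \<Rightarrow> 'm vfield" where
  "vert A g B F X = (\<lambda>p. orth_proj g p (vertical A B F p) (X p))"

definition horiz ::
  "('m, 'e::real_normed_vector) atlas \<Rightarrow> 'm metric \<Rightarrow> ('b, 'f::real_normed_vector) atlas \<Rightarrow>
   ('m \<Rightarrow> 'b) \<Rightarrow> 'm vfield \<Rightarrow> 'm vfield" where
  "horiz A g B F X = (\<lambda>p. orth_proj g p (horizontal A g B F p) (X p))"

text \<open>\<open>J U = \<phi> U + \<omega> U\<close>, with \<open>\<phi>\<close> on vector fields and \<open>\<omega>\<close> on single vectors.\<close>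

definition phi ::
  "('m, 'e::real_normed_vector) atlas \<Rightarrow> 'm metric \<Rightarrow> ('m \<Rightarrow> 'm tvec \<Rightarrow> 'm tvec) \<Rightarrow>
   ('b, 'f::real_normed_vector) atlas \<Rightarrow> ('m \<Rightarrow> 'b) \<Rightarrow> 'm vfield \<Rightarrow> 'm vfield" where
  "phi A g J B F U = vert A g B F (\<lambda>p. J p (U p))"

definition omega ::
  "('m, 'e::real_normed_vector) atlas \<Rightarrow> 'm metric \<Rightarrow> ('m \<Rightarrow> 'm tvec \<Rightarrow> 'm tvec) \<Rightarrow>
   ('b, 'f::real_normed_vector) atlas \<Rightarrow> ('m \<Rightarrow> 'b) \<Rightarrow> 'm \<Rightarrow> 'm tvec \<Rightarrow> 'm tvec" where
  "omega A g J B F p u = orth_proj g p (horizontal A g B F p) (J p u)"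

definition mu ::
  "('m, 'e::real_normed_vector) atlas \<Rightarrow> 'm metric \<Rightarrow> ('m \<Rightarrow> 'm tvec \<Rightarrow> 'm tvec) \<Rightarrow>
   ('b, 'f::real_normed_vector) atlas \<Rightarrow> ('m \<Rightarrow> 'b) \<Rightarrow> ('m \<Rightarrow> 'm tvec set) \<Rightarrow> 'm \<Rightarrow> 'm tvec set"
where
  "mu A g J B F D p =
     orth_compl_in g p (horizontal A g B F p) (omega A g J B F p ` D_perp A g B F D p)"

definition oneill_T ::
  "('m, 'e::real_normed_vector) atlas \<Rightarrow> 'm metric \<Rightarrow> 'm connection \<Rightarrow>
   ('b, 'f::real_normed_vector) atlas \<Rightarrow> ('m \<Rightarrow> 'b) \<Rightarrow> 'm vfield \<Rightarrow> 'm vfield \<Rightarrow> 'm vfield" where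
  "oneill_T A g nabla B F E G =
     horiz A g B F (nabla (vert A g B F E) (vert A g B F G)) +
     vert A g B F (nabla (vert A g B F E) (horiz A g B F G))"

text \<open>Horizontal and vertical parts of \<open>(\<nabla>\<^sub>E J) G\<close>.\<close>

definition tensor_P ::
  "('m, 'e::real_normed_vector) atlas \<Rightarrow> 'm metric \<Rightarrow> ('m \<Rightarrow> 'm tvec \<Rightarrow> 'm tvec) \<Rightarrow>
   'm connection \<Rightarrow> ('b, 'f::real_normed_vector) atlas \<Rightarrow> ('m \<Rightarrow> 'b) \<Rightarrow>
   'm vfield \<Rightarrow> 'm vfield \<Rightarrow> 'm vfield" where
  "tensor_P A g J nabla B F E G = horiz A g B F (nablaJ nabla J E G)"

definition tensor_Q ::
  "('m, 'e::real_normed_vector) atlas \<Rightarrow> 'm metric \<Rightarrow> ('m \<Rightarrow> 'm tvec \<Rightarrow> 'm tvec) \<Rightarrow>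
   'm connection \<Rightarrow> ('b, 'f::real_normed_vector) atlas \<Rightarrow> ('m \<Rightarrow> 'b) \<Rightarrow>
   'm vfield \<Rightarrow> 'm vfield \<Rightarrow> 'm vfield" where
  "tensor_Q A g J nabla B F E G = vert A g B F (nablaJ nabla J E G)"

end

theory Submission
  imports Defs
begin

text \<open>
  For sections \<open>U\<close>, \<open>V\<close> of \<open>\<D>\<close> we have \<open>\<phi> U = J U\<close> and \<open>\<phi> V = J V\<close>, so torsion-freeness and
  the nearly Kaehler identity \<open>(\<nabla>\<^sub>V J) U = - (\<nabla>\<^sub>U J) V\<close> give
  \<open>J [U, V] = \<nabla>\<^sub>U \<phi> V - \<nabla>\<^sub>V \<phi> U - 2 (\<nabla>\<^sub>U J) V\<close>. The two expressions of the theorem are the vertical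
  and the horizontal part of this field. Since \<open>[U, V]\<close> is vertical, write it as \<open>a + b\<close> with
  \<open>a\<close> in \<open>\<D>\<close> and \<open>b\<close> in its vertical complement. The horizontal part of \<open>J [U, V]\<close> is
  \<open>\<omega> b\<close>, which lies in \<open>\<mu>\<close> only if it vanishes; then \<open>J b\<close> is vertical, and if the vertical part
  \<open>J a + J b\<close> lies in \<open>\<D>\<close>, so does \<open>J b\<close>, hence also \<open>b\<close>, and \<open>b = 0\<close>.
\<close>

section \<open>Smooth functions and tangent spaces\<close>

lemma frechet_derivative_cong_open:
  assumes "open S" "x \<in> S" "\<And>y. y \<in> S \<Longrightarrow> f y = h y"
  shows "frechet_derivative f (at x) = frechet_derivative h (at x)"
proof -
  \<comment> \<open>\<open>frechet_derivative\<close> is a choice over this predicate, so it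
    suffices that both functions satisfy it for the same \<open>f'\<close>.\<close>
  have "(f has_derivative f') (at x) \<longleftrightarrow> (h has_derivative f') (at x)" for f'
    using assms has_derivative_transform_within_open[of f f' x UNIV S h]
      has_derivative_transform_within_open[of h f' x UNIV S f] by auto
  then show ?thesis
    by (simp add: frechet_derivative_def)
qed

lemma differentiable_cong_open:
  assumes "open S" "x \<in> S" "\<And>y. y \<in> S \<Longrightarrow> f y = h y" "f differentiable (at x)"
  shows "h differentiable (at x)"
  using assms has_derivative_transform_within_open[of f _ x UNIV S h]
  unfolding differentiable_def by blast

text \<open>\<open>Ck_on\<close> takes derivatives in the whole space, so values on \<open>S\<close>
  determine them because \<open>S\<close> is open. The induction step passes to directional
  derivatives, hence the generalization over both functions.\<close>

lemma Ck_on_cong_open: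
  assumes "open S" "\<And>x. x \<in> S \<Longrightarrow> f x = h x" "Ck_on k f S"
  shows "Ck_on k h S"
  using assms(2,3)
proof (induction k arbitrary: f h)
  case 0
  then show ?case
    using continuous_on_cong[of S S f h] by simp
next
  case (Suc k)
  have "h differentiable (at x)" if "x \<in> S" for x
    using differentiable_cong_open[OF assms(1) that, of f h] Suc.prems that by simp
  moreover have "Ck_on k (\<lambda>x. frechet_derivative h (at x) v) S" for v
  proof (rule Suc.IH[of "\<lambda>x. frechet_derivative f (at x) v"])
    show "frechet_derivative f (at x) v = frechet_derivative h (at x) v" if "x \<in> S" for x
      using frechet_derivative_cong_open[OF assms(1) that, of f h] Suc.prems(1) by simp
  qed (use Suc.prems(2) in simp)
  ultimately show ?case
    by simp
qed

text \<open>Leads to closure of vector fields under differences, from which smoothness of the Lie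
  bracket is obtained.\<close>

lemma Ck_on_diff:
  assumes "open S" "Ck_on k f S" "Ck_on k h S"
  shows "Ck_on k (\<lambda>x. f x - h x) S"
  using assms(2,3)
proof (induction k arbitrary: f h)
  case 0
  then show ?case
    by (simp add: continuous_on_diff)
next
  case (Suc k)
  have "Ck_on k (\<lambda>x. frechet_derivative (\<lambda>x. f x - h x) (at x) v) S" for v
  \<comment> \<open>Differentiability is known on \<open>S\<close> only, so the derivative of the
    difference splits only there.\<close>
  proof (rule Ck_on_cong_open[OF assms(1)])
    show "Ck_on k (\<lambda>x. frechet_derivative f (at x) v - frechet_derivative h (at x) v) S"
      using Suc by simp
    show "frechet_derivative f (at x) v - frechet_derivative h (at x) v =
        frechet_derivative (\<lambda>x. f x - h x) (at x) v" if "x \<in> S" for x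
    proof -
      have "((\<lambda>x. f x - h x) has_derivative
          (\<lambda>v. frechet_derivative f (at x) v - frechet_derivative h (at x) v)) (at x)"
        using Suc.prems that by (intro has_derivative_diff) (auto simp flip: frechet_derivative_works)
      from frechet_derivative_at[OF this] show ?thesis
        by metis
    qed
  qed
  then show ?case
    using Suc.prems by (auto intro: differentiable_diff)
qed

lemma smooth_on_imp_differentiable:
  assumes "smooth_on f S" "x \<in> S"
  shows "f differentiable (at x)"
proof -
  have "Ck_on (Suc 0) f S"
    using assms(1) unfolding smooth_on_def by blast
  then show ?thesis
    using assms(2) by simp
qed

lemma smooth_funs_diff:
  assumes "smooth_atlas A" "f \<in> smooth_funs A" "h \<in> smooth_funs A"
  shows "(\<lambda>p. f p - h p) \<in> smooth_funs A"
proof -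
  have "smooth_on ((\<lambda>p. f p - h p) \<circ> inv_into U \<phi>) (\<phi> ` U)" if "(U, \<phi>) \<in> A" for U \<phi>
  proof -
    have "open (\<phi> ` U)"
      using assms(1) that unfolding smooth_atlas_def by blast
    moreover have "smooth_on (f \<circ> inv_into U \<phi>) (\<phi> ` U)" "smooth_on (h \<circ> inv_into U \<phi>) (\<phi> ` U)"
      using assms(2,3) that unfolding smooth_funs_def by auto
    ultimately show ?thesis
      using Ck_on_diff unfolding smooth_on_def comp_def by blast
  qed
  then show ?thesis
    unfolding smooth_funs_def by blast
qed

lemma smooth_funs_differentiable:
  assumes "f \<in> smooth_funs A" "(U, \<phi>) \<in> A" "p \<in> U"
  shows "(f \<circ> inv_into U \<phi>) differentiable (at (\<phi> p))"
proof (rule smooth_on_imp_differentiable)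
  show "smooth_on (f \<circ> inv_into U \<phi>) (\<phi> ` U)"
    using assms(1,2) unfolding smooth_funs_def by blast
qed (use assms(3) in blast)

section \<open>Tangent spaces as images of charts\<close>

lemma linear_chart_vec:
  assumes "(U, \<phi>) \<in> A" "p \<in> U"
  shows "linear (chart_vec A U \<phi> p)"
proof -
  have "linear (frechet_derivative (f \<circ> inv_into U \<phi>) (at (\<phi> p)))" if "f \<in> smooth_funs A" for f
    using smooth_funs_differentiable[OF that assms] by (rule linear_frechet_derivative)
  then show ?thesis
    by (auto intro!: linearI simp: chart_vec_def fun_eq_iff scaleR_fun_def plus_fun_def
        linear_add linear_cmul)
qed

text \<open>Chain rule for the coordinate change. The composite agrees with the coordinate
  expression of \<open>f\<close> in the chart \<open>\<psi>\<close> only on the image of the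
  overlap, which is open because charts are homeomorphisms.\<close>

lemma chart_vec_transition:
  assumes A: "smooth_atlas A" and U: "(U, \<phi>) \<in> A" "p \<in> U" and V: "(V, \<psi>) \<in> A" "p \<in> V"
  shows "chart_vec A V \<psi> p w =
    chart_vec A U \<phi> p (frechet_derivative (\<phi> \<circ> inv_into V \<psi>) (at (\<psi> p)) w)"
proof -
  have opV: "open V" "open (\<psi> ` V)" "homeomorphism V (\<psi> ` V) \<psi> (inv_into V \<psi>)" and opU: "open U"
    using A U V unfolding smooth_atlas_def by blast+
  have inv: "inv_into V \<psi> (\<psi> q) = q" if "q \<in> V" for q
    using opV(3) that unfolding homeomorphism_def by blast
  have invU: "inv_into U \<phi> (\<phi> q) = q" if "q \<in> U" for q
    using A U that unfolding smooth_atlas_def homeomorphism_def by blast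
  have "openin (top_of_set (\<psi> ` V)) (\<psi> ` (V \<inter> U))"
    using homeomorphism_imp_open_map[OF opV(3)] opU by (simp add: openin_open_Int)
  then have op: "open (\<psi> ` (V \<inter> U))"
    using opV(2) openin_open_eq by blast
  have mem: "\<psi> p \<in> \<psi> ` (V \<inter> U)"
    using U V by blast
  have trans: "(\<phi> \<circ> inv_into V \<psi>) differentiable (at (\<psi> p))"
  proof (rule smooth_on_imp_differentiable[OF _ mem])
    show "smooth_on (\<phi> \<circ> inv_into V \<psi>) (\<psi> ` (V \<inter> U))"
      using A U V unfolding smooth_atlas_def by blast
  qed
  have "frechet_derivative (f \<circ> inv_into V \<psi>) (at (\<psi> p)) w =
      frechet_derivative (f \<circ> inv_into U \<phi>) (at (\<phi> p))
        (frechet_derivative (\<phi> \<circ> inv_into V \<psi>) (at (\<psi> p)) w)" if f: "f \<in> smooth_funs A" for f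
  proof -
    have "(f \<circ> inv_into U \<phi>) differentiable (at ((\<phi> \<circ> inv_into V \<psi>) (\<psi> p)))"
      using smooth_funs_differentiable[OF f U] inv V by simp
    from frechet_derivative_compose[OF trans this]
    have "frechet_derivative ((f \<circ> inv_into U \<phi>) \<circ> (\<phi> \<circ> inv_into V \<psi>)) (at (\<psi> p)) w =
        frechet_derivative (f \<circ> inv_into U \<phi>) (at (\<phi> p))
          (frechet_derivative (\<phi> \<circ> inv_into V \<psi>) (at (\<psi> p)) w)"
      using inv[OF V(2)] by (simp add: o_def)
    moreover have "frechet_derivative ((f \<circ> inv_into U \<phi>) \<circ> (\<phi> \<circ> inv_into V \<psi>)) (at (\<psi> p)) =
        frechet_derivative (f \<circ> inv_into V \<psi>) (at (\<psi> p))"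
      by (rule frechet_derivative_cong_open[OF op mem]) (auto simp: inv invU)
    ultimately show ?thesis
      by simp
  qed
  then show ?thesis
    by (simp add: chart_vec_def fun_eq_iff)
qed

lemma chart_at:
  assumes "smooth_atlas A"
  obtains U \<phi> where "(U, \<phi>) \<in> A" "p \<in> U"
proof -
  have "p \<in> \<Union>(fst ` A)"
    using assms unfolding smooth_atlas_def by simp
  then show ?thesis
    using that by fastforce
qed

text \<open>One chart accounts for vectors from all charts, so the tangent space is the image of a
  single linear map; linear structure and finite dimension follow.\<close>

lemma tangent_space_eq_range:
  assumes "smooth_atlas A" "(U, \<phi>) \<in> A" "p \<in> U"
  shows "tangent_space A p = range (chart_vec A U \<phi> p)"
proof
  show "tangent_space A p \<subseteq> range (chart_vec A U \<phi> p)"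
    unfolding tangent_space_def using chart_vec_transition[OF assms] by auto
  show "range (chart_vec A U \<phi> p) \<subseteq> tangent_space A p"
    unfolding tangent_space_def using assms(2,3) by blast
qed

lemma subspace_tangent_space:
  assumes "smooth_atlas A"
  shows "subspace (tangent_space A p)"
proof -
  obtain U \<phi> where U: "(U, \<phi>) \<in> A" "p \<in> U"
    using chart_at[OF assms] .
  show ?thesis
    using linear_subspace_image[OF linear_chart_vec[OF U] subspace_UNIV]
      tangent_space_eq_range[OF assms U] by simp
qed

text \<open>The finite spanning set of the model space is pushed forward by a chart. Orthogonal
  projections exist because of this.\<close>

lemma tangent_space_finite_span:
  fixes A :: "('m::{t2_space,second_countable_topology}, 'e::real_normed_vector) atlas"
  assumes "smooth_atlas A"
  obtains C where "finite C" "tangent_space A p \<subseteq> span C"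
proof -
  obtain U \<phi> where U: "(U, \<phi>) \<in> A" "p \<in> U"
    using chart_at[OF assms] .
  obtain S :: "'e set" where S: "finite S" "span S = UNIV"
    using assms unfolding smooth_atlas_def by blast
  have "tangent_space A p = span (chart_vec A U \<phi> p ` S)"
    using tangent_space_eq_range[OF assms U] linear_span_image[OF linear_chart_vec[OF U], of S] S(2)
    by simp
  then show ?thesis
    using that S(1) by blast
qed

text \<open>Whether or not a constant counts as smooth, the value is 0: by differentiation in one
  case, by the guard in \<open>chart_vec\<close> in the other.\<close>

lemma tangent_space_const:
  assumes "v \<in> tangent_space A p"
  shows "v (\<lambda>q. c) = 0"
proof -
  have "frechet_derivative (\<lambda>x. c) (at y) w = 0" for y :: 'b and w and c :: real
    by (simp add: frechet_derivative_const)
  then show ?thesis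
    using assms unfolding tangent_space_def chart_vec_def by (auto simp: comp_def)
qed

lemma vector_fields_diff:
  assumes "smooth_atlas A" "X \<in> vector_fields A" "Y \<in> vector_fields A"
  shows "X - Y \<in> vector_fields A"
  using assms subspace_diff[OF subspace_tangent_space[OF assms(1)]] smooth_funs_diff[OF assms(1)]
  unfolding vector_fields_def by (auto simp: fun_diff_def)

section \<open>Orthogonal projections\<close>

text \<open>The metric is constrained on tangent vectors only, while the ambient type contains all
  functionals; hence axioms relative to a carrier \<open>T\<close>.\<close>

locale inner_product_on =
  fixes T :: "'a::real_vector set" and ip :: "'a \<Rightarrow> 'a \<Rightarrow> real"
  assumes subspace: "subspace T"
    and commute: "u \<in> T \<Longrightarrow> v \<in> T \<Longrightarrow> ip u v = ip v u"
    and pos: "u \<in> T \<Longrightarrow> u \<noteq> 0 \<Longrightarrow> ip u u > 0"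
    and scale_left: "u \<in> T \<Longrightarrow> v \<in> T \<Longrightarrow> ip (c *\<^sub>R u) v = c * ip u v"
    and add_left: "u \<in> T \<Longrightarrow> w \<in> T \<Longrightarrow> v \<in> T \<Longrightarrow> ip (u + w) v = ip u v + ip w v"
begin

lemmas T_closed = subspace_add[OF subspace] subspace_diff[OF subspace] subspace_scale[OF subspace]

lemma diff_left: "u \<in> T \<Longrightarrow> w \<in> T \<Longrightarrow> v \<in> T \<Longrightarrow> ip (u - w) v = ip u v - ip w v"
  using add_left[of "u - w" w v] by (simp add: T_closed)

lemma add_right: "u \<in> T \<Longrightarrow> v \<in> T \<Longrightarrow> w \<in> T \<Longrightarrow> ip u (v + w) = ip u v + ip u w"
  by (metis T_closed(1) add_left commute)

lemma scale_right: "u \<in> T \<Longrightarrow> v \<in> T \<Longrightarrow> ip u (c *\<^sub>R v) = c * ip u v"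
  by (metis T_closed(3) scale_left commute)

lemma eq_zero: "u \<in> T \<Longrightarrow> ip u u = 0 \<Longrightarrow> u = 0"
  using pos by force

text \<open>The difference of two candidates lies in \<open>S\<close> and is orthogonal to
  itself.\<close>

lemma projection_unique:
  assumes "subspace S" "S \<subseteq> T" "v \<in> T" "u \<in> S" "u' \<in> S"
    and "\<forall>w\<in>S. ip (v - u) w = 0" "\<forall>w\<in>S. ip (v - u') w = 0"
  shows "u = u'"
proof -
  have d: "u - u' \<in> S"
    using assms subspace_diff by blast
  have "ip (u - u') (u - u') = ip ((v - u') - (v - u)) (u - u')"
    by simp
  also have "\<dots> = 0"
    using assms d by (subst diff_left) (auto simp: T_closed subset_iff)
  finally show ?thesis
    using eq_zero d assms(2) by fastforce
qed

text \<open>One Gram--Schmidt step per element of the spanning set.\<close>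

lemma projection_exists_span:
  assumes "finite C" "C \<subseteq> T" "v \<in> T"
  shows "\<exists>u\<in>span C. \<forall>w\<in>span C. ip (v - u) w = 0"
  using assms
proof (induction C arbitrary: v rule: finite_induct)
  case empty
  have "ip v 0 = 0"
    using scale_right[OF empty.prems(2), of v 0] empty.prems by simp
  then show ?case
    by simp
next
  case (insert b C)
  have CT: "span C \<subseteq> T" "b \<in> T"
    using insert.prems subspace span_minimal[of C T] by auto
  obtain b0 where b0: "b0 \<in> span C" "\<forall>w\<in>span C. ip (b - b0) w = 0"
    using insert.IH[of b] insert.prems by auto
  obtain u0 where u0: "u0 \<in> span C" "\<forall>w\<in>span C. ip (v - u0) w = 0"
    using insert.IH[of v] insert.prems by auto
  \<comment> \<open>The component of \<open>b\<close> orthogonal to \<open>span C\<close>.\<close>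
  define b' where "b' = b - b0"
  have T: "b' \<in> T" "u0 \<in> T" "v \<in> T" "v - u0 \<in> T"
    using CT b0(1) u0(1) insert.prems by (auto simp: b'_def T_closed subset_iff)
  \<comment> \<open>The coefficient makes \<open>v - u\<close> orthogonal to \<open>b'\<close>. If
    \<open>b' = 0\<close>, the correction vanishes.\<close>
  define u where "u = u0 + (ip (v - u0) b' / ip b' b') *\<^sub>R b'"
  have C_insert: "x \<in> span (insert b C)" if "x \<in> span C" for x
    using that span_mono[of C "insert b C"] by blast
  have "b' \<in> span (insert b C)"
    unfolding b'_def by (intro span_diff[OF span_base C_insert[OF b0(1)]]) simp
  then have "u \<in> span (insert b C)"
    unfolding u_def by (intro span_add[OF C_insert[OF u0(1)] span_scale])
  moreover have "ip (v - u) w = 0" if "w \<in> span (insert b C)" for w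
  proof -
    obtain k where k: "w - k *\<^sub>R b \<in> span C"
      using \<open>w \<in> span (insert b C)\<close> span_breakdown_eq by blast
    \<comment> \<open>Regroups \<open>w\<close> along \<open>span C\<close> and \<open>b'\<close>,
      so that orthogonality can be tested on each separately.\<close>
    define c where "c = (w - k *\<^sub>R b) + k *\<^sub>R b0"
    have c: "c \<in> span C"
      unfolding c_def by (intro span_add k span_scale b0)
    have w: "w = c + k *\<^sub>R b'"
      by (simp add: c_def b'_def algebra_simps)
    have cT: "c \<in> T"
      using c CT by blast
    have vu: "v - u = (v - u0) - (ip (v - u0) b' / ip b' b') *\<^sub>R b'"
      by (simp add: u_def algebra_simps)
    have "ip (v - u) c = 0"
      unfolding vu using T cT u0(2) b0(2) c
      by (subst diff_left) (simp_all add: scale_left T_closed b'_def)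
    moreover have "ip (v - u) b' = 0"
      unfolding vu using T pos[of b'] scale_right[of "v - u0" b' 0]
      by (cases "b' = 0", simp, subst diff_left) (simp_all add: scale_left T_closed)
    ultimately show ?thesis
      unfolding w vu using T cT by (simp add: add_right scale_right T_closed)
  qed
  ultimately show ?case
    by blast
qed

text \<open>A basis of \<open>S\<close> is independent inside a finitely spanned space, hence
  finite, and Gram-Schmidt applies to it.\<close>

lemma projection_exists:
  assumes "finite C" "T \<subseteq> span C" "subspace S" "S \<subseteq> T" "v \<in> T"
  shows "\<exists>u\<in>S. \<forall>w\<in>S. ip (v - u) w = 0"
proof -
  obtain E where E: "E \<subseteq> S" "independent E" "S \<subseteq> span E"
    using basis_exists[of S] by metis
  then have "finite E"
    using independent_span_bound[OF assms(1) E(2)] assms(2,4) by blast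
  moreover have "span E = S"
    using E assms(3) span_minimal by blast
  ultimately show ?thesis
    using projection_exists_span[of E v] E(1) assms(4,5) by auto
qed

end

section \<open>Vertical and horizontal parts of \<open>J [U, V]\<close>\<close>

lemma riemannian_manifold_inner_product_on:
  assumes "riemannian_manifold A g"
  shows "inner_product_on (tangent_space A p) (g p)"
  using assms subspace_tangent_space unfolding riemannian_manifold_def inner_product_on_def by blast

lemma subspace_vertical:
  assumes "smooth_atlas A"
  shows "subspace (vertical A B F p)"
  using subspace_tangent_space[OF assms, of p]
  unfolding subspace_def vertical_def differential_def
  by (auto simp: fun_eq_iff scaleR_fun_def)

text \<open>A vertical field annihilates \<open>h \<circ> F\<close> at every point, so each iterated
  derivative in the bracket is a derivative of the zero function. Tangency of the bracket is
  supplied later by torsion-freeness.\<close>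

lemma lie_bracket_vertical:
  fixes U V :: "'m vfield"
  assumes "\<And>p. U p \<in> vertical A B F p" "\<And>p. V p \<in> vertical A B F p"
    and "lie_bracket U V p \<in> tangent_space A p"
  shows "lie_bracket U V p \<in> vertical A B F p"
proof -
  have "w (h \<circ> F) = 0" if "w \<in> vertical A B F q" "h \<in> smooth_funs B" for w q h
    using that unfolding vertical_def differential_def by (auto simp: fun_eq_iff dest: spec[of _ h])
  from this[OF assms(1)] this[OF assms(2)]
  have "U q (h \<circ> F) = 0" "V q (h \<circ> F) = 0" if "h \<in> smooth_funs B" for q h
    using that by blast+
  moreover have "U p (\<lambda>q. 0) = 0" "V p (\<lambda>q. 0) = 0"
    using assms(1,2)[of p] tangent_space_const[where A=A and p=p] by (simp_all add: vertical_def)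
  ultimately have "differential B F (lie_bracket U V p) = 0"
    by (simp add: differential_def lie_bracket_def fun_eq_iff)
  then show ?thesis
    using assms(3) by (simp add: vertical_def)
qed

section \<open>Pointwise linear algebra of projections, \<open>J\<close> and
  \<open>D\<close>\<close>

locale nearly_kaehler_generic_submersion =
  fixes A :: "('m::{t2_space,second_countable_topology}, 'e::real_normed_vector) atlas"
    and g :: "'m metric"
    and J :: "'m \<Rightarrow> 'm tvec \<Rightarrow> 'm tvec"
    and nabla :: "'m connection"
    and B :: "('b::{t2_space,second_countable_topology}, 'f::real_normed_vector) atlas"
    and gB :: "'b metric"
    and F :: "'m \<Rightarrow> 'b"
    and D :: "'m \<Rightarrow> 'm tvec set"
  assumes nearly_kaehler: "nearly_kaehler A g J nabla"
    and generic: "generic_riemannian_submersion A g J B gB F D"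
begin

abbreviation "TM \<equiv> tangent_space A"
abbreviation "Ver \<equiv> vertical A B F"
abbreviation "Hor \<equiv> horizontal A g B F"
abbreviation "ver p \<equiv> orth_proj g p (Ver p)"
abbreviation "hor p \<equiv> orth_proj g p (Hor p)"

lemma almost_hermitian: "almost_hermitian A g J"
  using nearly_kaehler by (simp add: nearly_kaehler_def)

lemma riemannian: "riemannian_manifold A g"
  using almost_hermitian by (simp add: almost_hermitian_def)

lemma atlas: "smooth_atlas A"
  using riemannian by (simp add: riemannian_manifold_def)

sublocale inner_product_on "TM p" "g p" for p
  by (rule riemannian_manifold_inner_product_on[OF riemannian])

lemma Ver_subset: "Ver p \<subseteq> TM p"
  by (auto simp: vertical_def)

lemma Hor_subset: "Hor p \<subseteq> TM p"
  by (auto simp: horizontal_def orth_compl_in_def)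

lemma Ver_subspace: "subspace (Ver p)"
  by (rule subspace_vertical[OF atlas])

lemma subspace_orth_compl_in:
  assumes "subspace W" "W \<subseteq> TM p" "S \<subseteq> TM p"
  shows "subspace (orth_compl_in g p W S)"
proof (rule subspaceI)
  show "0 \<in> orth_compl_in g p W S"
    using assms scale_left[of 0 p _ 0] subspace_0[OF subspace, of p]
    by (auto simp: orth_compl_in_def subspace_0)
  show "x + y \<in> orth_compl_in g p W S"
    if "x \<in> orth_compl_in g p W S" "y \<in> orth_compl_in g p W S" for x y
    using that assms by (auto simp: orth_compl_in_def subspace_add add_left subset_iff)
  show "c *\<^sub>R x \<in> orth_compl_in g p W S" if "x \<in> orth_compl_in g p W S" for c x
    using that assms by (auto simp: orth_compl_in_def subspace_scale scale_left subset_iff)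
qed

lemma Hor_subspace: "subspace (Hor p)"
  unfolding horizontal_def by (intro subspace_orth_compl_in subspace Ver_subset order_refl)

lemma generic_at:
  shows D_subset: "D p \<subseteq> Ver p"
    and Ver_eq: "Ver p = {u + v | u v. u \<in> D p \<and> v \<in> D_perp A g B F D p}"
    and J_D: "J p ` D p = D p"
proof -
  note * = generic[unfolded generic_riemannian_submersion_def, THEN conjunct2, THEN conjunct2,
      THEN spec, of p]
  show "D p \<subseteq> Ver p"
    using * by (rule conjunct1)
  show "Ver p = {u + v | u v. u \<in> D p \<and> v \<in> D_perp A g B F D p}"
    using *[THEN conjunct2] by (rule conjunct1)
  show "J p ` D p = D p"
    using *[THEN conjunct2, THEN conjunct2, THEN conjunct2] by (rule conjunct1)
qed

text \<open>At each point \<open>D p\<close> is the span of a local frame.\<close>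

lemma D_subspace: "subspace (D p)"
proof -
  have "distribution A D"
    using generic by (simp add: generic_riemannian_submersion_def)
  then have "\<exists>C. span C = D p"
    unfolding distribution_def by meson
  then show ?thesis
    using subspace_span by metis
qed

text \<open>Uniqueness makes the definite description computable: exhibiting one candidate with
  orthogonal residual suffices.\<close>

lemma orth_proj_eqI:
  assumes "subspace S" "S \<subseteq> TM p" "v \<in> TM p" "u \<in> S" "\<forall>w\<in>S. g p (v - u) w = 0"
  shows "orth_proj g p S v = u"
  unfolding orth_proj_def
  using assms projection_unique[OF assms(1-3)] by (intro the_equality) auto

lemma ver:
  assumes "v \<in> TM p"
  shows "ver p v \<in> Ver p" "w \<in> Ver p \<Longrightarrow> g p (v - ver p v) w = 0"
proof -
  obtain C where "finite C" "TM p \<subseteq> span C"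
    using tangent_space_finite_span[OF atlas] .
  then obtain u where u: "u \<in> Ver p" "\<forall>w\<in>Ver p. g p (v - u) w = 0"
    using projection_exists Ver_subspace Ver_subset assms by metis
  then have "ver p v = u"
    using orth_proj_eqI Ver_subspace Ver_subset assms by blast
  then show "ver p v \<in> Ver p" "w \<in> Ver p \<Longrightarrow> g p (v - ver p v) w = 0"
    using u by auto
qed

lemma ver_tangent: "v \<in> TM p \<Longrightarrow> ver p v \<in> TM p"
  using ver(1) Ver_subset by blast

text \<open>The residual of the vertical projection is horizontal, and what it leaves of
  \<open>v\<close> is vertical. This reduces the rules for \<open>hor\<close> to those for
  \<open>ver\<close>.\<close>

lemma hor_eq:
  assumes "v \<in> TM p"
  shows "hor p v = v - ver p v"
proof (rule orth_proj_eqI[OF Hor_subspace Hor_subset assms])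
  show "v - ver p v \<in> Hor p"
    using assms ver ver_tangent by (simp add: horizontal_def orth_compl_in_def T_closed)
  show "\<forall>w\<in>Hor p. g p (v - (v - ver p v)) w = 0"
  proof
    fix w assume w: "w \<in> Hor p"
    then have "g p w (ver p v) = 0"
      using ver(1)[OF assms] by (simp add: horizontal_def orth_compl_in_def)
    then show "g p (v - (v - ver p v)) w = 0"
      using commute[of w p "ver p v"] ver_tangent[OF assms] w Hor_subset by auto
  qed
qed

lemma zero_left: "w \<in> TM p \<Longrightarrow> g p 0 w = 0"
  using scale_left[of w p w 0] by simp

lemma ver_of_vertical: "v \<in> Ver p \<Longrightarrow> ver p v = v"
  using Ver_subset zero_left by (intro orth_proj_eqI Ver_subspace) auto

lemma hor_of_vertical: "v \<in> Ver p \<Longrightarrow> hor p v = 0"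
  using hor_eq ver_of_vertical Ver_subset by fastforce

lemma ver_add:
  assumes "u \<in> TM p" "v \<in> TM p"
  shows "ver p (u + v) = ver p u + ver p v"
proof (rule orth_proj_eqI[OF Ver_subspace Ver_subset])
  show "ver p u + ver p v \<in> Ver p"
    using assms by (intro subspace_add[OF Ver_subspace] ver)
  show "\<forall>w\<in>Ver p. g p (u + v - (ver p u + ver p v)) w = 0"
    using assms ver_tangent ver(2) Ver_subset by (auto simp: add_diff_add add_left T_closed subset_iff)
qed (use assms T_closed in auto)

lemma ver_scale:
  assumes "u \<in> TM p"
  shows "ver p (c *\<^sub>R u) = c *\<^sub>R ver p u"
proof (rule orth_proj_eqI[OF Ver_subspace Ver_subset])
  show "c *\<^sub>R ver p u \<in> Ver p"
    using assms by (intro subspace_scale[OF Ver_subspace] ver)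
  show "\<forall>w\<in>Ver p. g p (c *\<^sub>R u - c *\<^sub>R ver p u) w = 0"
    using assms ver_tangent ver(2) Ver_subset
    by (auto simp: scaleR_diff_right[symmetric] scale_left T_closed subset_iff)
qed (use assms T_closed in auto)

lemma ver_diff:
  assumes "u \<in> TM p" "v \<in> TM p"
  shows "ver p (u - v) = ver p u - ver p v"
  using ver_add[of "u - v" p v] assms T_closed by (simp add: algebra_simps)

lemma hor_add: "u \<in> TM p \<Longrightarrow> v \<in> TM p \<Longrightarrow> hor p (u + v) = hor p u + hor p v"
  by (simp add: hor_eq ver_add T_closed)

lemma hor_scale: "u \<in> TM p \<Longrightarrow> hor p (c *\<^sub>R u) = c *\<^sub>R hor p u"
  by (simp add: hor_eq ver_scale T_closed scaleR_diff_right)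

lemma hor_diff: "u \<in> TM p \<Longrightarrow> v \<in> TM p \<Longrightarrow> hor p (u - v) = hor p u - hor p v"
  by (simp add: hor_eq ver_diff T_closed)

lemma J_tangent: "u \<in> TM p \<Longrightarrow> J p u \<in> TM p"
  using almost_hermitian unfolding almost_hermitian_def by blast

lemma J_add: "u \<in> TM p \<Longrightarrow> v \<in> TM p \<Longrightarrow> J p (u + v) = J p u + J p v"
  using almost_hermitian unfolding almost_hermitian_def by blast

lemma J_diff: "u \<in> TM p \<Longrightarrow> v \<in> TM p \<Longrightarrow> J p (u - v) = J p u - J p v"
  using J_add[of "u - v" p v] by (simp add: T_closed algebra_simps)

lemma J_J: "u \<in> TM p \<Longrightarrow> J p (J p u) = - u"
  using almost_hermitian unfolding almost_hermitian_def by blast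

lemma J_field: "X \<in> vector_fields A \<Longrightarrow> (\<lambda>p. J p (X p)) \<in> vector_fields A"
  using almost_hermitian unfolding almost_hermitian_def by blast

lemma J_D_iff: "u \<in> TM p \<Longrightarrow> J p u \<in> D p \<longleftrightarrow> u \<in> D p"
proof -
  assume u: "u \<in> TM p"
  show ?thesis
  proof
    \<comment> \<open>Applying \<open>J\<close> once more stays in \<open>D\<close> and returns
      \<open>- u\<close>.\<close>
    assume "J p u \<in> D p"
    then have "- u \<in> D p"
      using J_D J_J[OF u] by force
    then show "u \<in> D p"
      using subspace_neg[OF D_subspace] by fastforce
  qed (use J_D in blast)
qed

text \<open>The algebraic core of the converse direction, applied at each point to the
  bracket.\<close>

lemma in_D_of_J_parts:
  assumes x: "x \<in> Ver p" and v: "ver p (J p x) \<in> D p" and h: "hor p (J p x) \<in> mu A g J B F D p"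
  shows "x \<in> D p"
proof -
  obtain a b where ab: "x = a + b" "a \<in> D p" "b \<in> D_perp A g B F D p"
    using x Ver_eq by blast
  have T: "a \<in> TM p" "b \<in> TM p"
    using ab D_subset Ver_subset by (auto simp: D_perp_def orth_compl_in_def)
  have Ja: "J p a \<in> D p"
    using ab(2) J_D_iff T by blast
  have Jx: "J p x = J p a + J p b"
    using ab(1) J_add T by simp
  have "hor p (J p x) = hor p (J p b)"
    using hor_add[of "J p a" p "J p b"] hor_of_vertical[of "J p a" p] Ja D_subset T J_tangent
    by (auto simp: Jx)
  then have "hor p (J p b) \<in> mu A g J B F D p"
    using h by simp
  \<comment> \<open>This vector is \<open>omega\<close> of \<open>b\<close>, so membership in
    \<open>mu\<close> makes it orthogonal to itself.\<close>
  then have "hor p (J p b) \<in> TM p" "g p (hor p (J p b)) (hor p (J p b)) = 0"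
    using ab(3) Hor_subset unfolding mu_def omega_def orth_compl_in_def by blast+
  then have "hor p (J p b) = 0"
    by (rule eq_zero)
  then have "ver p (J p b) = J p b"
    using hor_eq J_tangent T by simp
  then have "ver p (J p x) = J p a + J p b"
    using ver_add[of "J p a" p "J p b"] ver_of_vertical[of "J p a" p] Ja D_subset T J_tangent
    by (auto simp: Jx)
  then have "J p b \<in> D p"
    using v Ja subspace_diff[OF D_subspace, of "J p a + J p b" p "J p a"] by simp
  \<comment> \<open>This already places \<open>a + b\<close> in \<open>D\<close>, so the vanishing
    of \<open>b\<close> is not extracted.\<close>
  then have "b \<in> D p"
    using J_D_iff T by blast
  then show ?thesis
    using ab subspace_add[OF D_subspace] by blast
qed

section \<open>The connection, \<open>phi\<close> and O'Neill's tensor on sections of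
  \<open>D\<close>\<close>

lemma nabla_field: "X \<in> vector_fields A \<Longrightarrow> Y \<in> vector_fields A \<Longrightarrow> nabla X Y \<in> vector_fields A"
  using nearly_kaehler unfolding nearly_kaehler_def levi_civita_def by blast

lemma torsion_free:
  "X \<in> vector_fields A \<Longrightarrow> Y \<in> vector_fields A \<Longrightarrow> nabla X Y - nabla Y X = lie_bracket X Y"
  using nearly_kaehler unfolding nearly_kaehler_def levi_civita_def by blast

lemma field_tangent: "X \<in> vector_fields A \<Longrightarrow> X p \<in> TM p"
  by (simp add: vector_fields_def)

lemma zero_field:
  assumes "X \<in> vector_fields A"
  shows "0 \<in> vector_fields A"
  using vector_fields_diff[OF atlas assms assms] by simp

lemma nabla_zero:
  assumes "X \<in> vector_fields A"
  shows "nabla X 0 = 0"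
proof -
  have "nabla X (0 + 0) = nabla X 0 + nabla X 0"
    using nearly_kaehler assms zero_field[OF assms]
    unfolding nearly_kaehler_def levi_civita_def by blast
  then show ?thesis
    by simp
qed

lemma J_in_D: "W \<in> sections A D \<Longrightarrow> J p (W p) \<in> D p"
  using J_D_iff field_tangent by (simp add: sections_def)

text \<open>\<open>J\<close> preserves \<open>D\<close>, whose vectors are vertical, so the vertical
  projection changes nothing.\<close>

lemma phi_eq_J: "W \<in> sections A D \<Longrightarrow> phi A g J B F W = (\<lambda>p. J p (W p))"
  using J_in_D D_subset ver_of_vertical by (auto simp: phi_def vert_def subset_iff)

text \<open>Both arguments are vertical, so the second summand of the tensor is the vertical part of
  \<open>nabla X 0\<close>, which vanishes.\<close>

lemma oneill_T_phi:
  assumes X: "X \<in> sections A D" and Y: "Y \<in> sections A D"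
  shows "oneill_T A g nabla B F X (phi A g J B F Y) = horiz A g B F (nabla X (phi A g J B F Y))"
proof -
  have vert_eq: "vert A g B F W = W" if "\<And>p. W p \<in> D p" for W
    using ver_of_vertical[OF subsetD[OF D_subset that]] by (simp add: vert_def)
  have horiz_eq: "horiz A g B F W = 0" if "\<And>p. W p \<in> D p" for W
    using hor_of_vertical[OF subsetD[OF D_subset that]] by (simp add: horiz_def zero_fun_def)
  have XD: "X p \<in> D p" "phi A g J B F Y p \<in> D p" for p
    using X J_in_D[OF Y] phi_eq_J[OF Y] by (auto simp: sections_def)
  have "vert A g B F 0 = (0 :: 'm vfield)"
    using ver_of_vertical subspace_0[OF Ver_subspace] by (simp add: vert_def zero_fun_def)
  moreover have "nabla X 0 = 0"
    using X nabla_zero by (simp add: sections_def)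
  ultimately show ?thesis
    by (simp add: oneill_T_def vert_eq[OF XD(1)] vert_eq[OF XD(2)] horiz_eq[OF XD(2)])
qed

section \<open>The bracket of two sections of \<open>D\<close>\<close>

context
  fixes U V
  assumes U: "U \<in> sections A D" and V: "V \<in> sections A D"
begin

text \<open>Torsion-freeness exhibits the bracket as a difference of two covariant derivatives,
  which gives tangency and smoothness without coordinates.\<close>

lemma lie_bracket_field: "lie_bracket U V \<in> vector_fields A"
  using U V torsion_free vector_fields_diff[OF atlas] nabla_field
  unfolding sections_def by (metis (no_types, lifting) mem_Collect_eq)

lemma lie_bracket_in_Ver: "lie_bracket U V p \<in> Ver p"
  using U V D_subset lie_bracket_field
  by (intro lie_bracket_vertical field_tangent) (auto simp: sections_def)

lemma J_lie_bracket:
  "J p (lie_bracket U V p) =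
    nabla U (phi A g J B F V) p - nabla V (phi A g J B F U) p - 2 *\<^sub>R nablaJ nabla J U V p"
proof -
  have f: "U \<in> vector_fields A" "V \<in> vector_fields A"
    using U V by (auto simp: sections_def)
  have "nablaJ nabla J U V + nablaJ nabla J V U = 0"
    using nearly_kaehler f unfolding nearly_kaehler_def by blast
  then have nk: "nablaJ nabla J V U p = - nablaJ nabla J U V p"
    by (metis add_eq_0_iff plus_fun_apply zero_fun_apply)
  have "lie_bracket U V p = nabla U V p - nabla V U p"
    using torsion_free[OF f] by (metis fun_diff_def)
  then have "J p (lie_bracket U V p) = J p (nabla U V p) - J p (nabla V U p)"
    using J_diff field_tangent nabla_field f by metis
  \<comment> \<open>Unfolding \<open>nablaJ\<close> cancels the terms
    \<open>J p (nabla U V p)\<close> and \<open>J p (nabla V U p)\<close>; the nearly Kaehler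
    identity then doubles the remaining one.\<close>
  also have "\<dots> = nabla U (phi A g J B F V) p - nabla V (phi A g J B F U) p
      - (nablaJ nabla J U V p - nablaJ nabla J V U p)"
    by (simp add: phi_eq_J U V nablaJ_def)
  finally show ?thesis
    by (simp add: nk scaleR_2)
qed

lemma field_tangents:
  "nabla U (phi A g J B F V) p \<in> TM p" "nabla V (phi A g J B F U) p \<in> TM p"
  "nablaJ nabla J U V p \<in> TM p"
proof -
  have f: "U \<in> vector_fields A" "V \<in> vector_fields A"
    using U V by (auto simp: sections_def)
  then show "nabla U (phi A g J B F V) p \<in> TM p" "nabla V (phi A g J B F U) p \<in> TM p"
    by (simp_all add: phi_eq_J U V field_tangent nabla_field J_field)
  show "nablaJ nabla J U V p \<in> TM p"
    unfolding nablaJ_def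
    by (intro T_closed(2) J_tangent field_tangent nabla_field J_field f)
qed

lemma vertical_expression:
  "(vert A g B F (nabla U (phi A g J B F V)) - vert A g B F (nabla V (phi A g J B F U))
     - 2 *\<^sub>R tensor_Q A g J nabla B F U V) = (\<lambda>p. ver p (J p (lie_bracket U V p)))"
  using field_tangents
  \<comment> \<open>The type instance limits extensionality to points of the manifold, so that
    tangent vectors, themselves functions, stay intact.\<close>
  by (auto simp: fun_eq_iff[where 'a='m] J_lie_bracket ver_diff ver_scale T_closed vert_def
      tensor_Q_def scaleR_fun_def[where 'a='m])

lemma horizontal_expression:
  "(oneill_T A g nabla B F U (phi A g J B F V) - oneill_T A g nabla B F V (phi A g J B F U)
     - 2 *\<^sub>R tensor_P A g J nabla B F U V) = (\<lambda>p. hor p (J p (lie_bracket U V p)))"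
  using field_tangents
  by (auto simp: fun_eq_iff[where 'a='m] J_lie_bracket hor_diff hor_scale T_closed horiz_def
      oneill_T_phi U V tensor_P_def scaleR_fun_def[where 'a='m])

lemma lie_bracket_in_D_iff:
  "lie_bracket U V \<in> sections A D \<longleftrightarrow>
    (\<lambda>p. ver p (J p (lie_bracket U V p))) \<in> sections A D \<and>
    (\<lambda>p. hor p (J p (lie_bracket U V p))) \<in> sections A (mu A g J B F D)"
    (is "_ \<longleftrightarrow> ?ver \<and> ?hor")
proof
  assume L: "lie_bracket U V \<in> sections A D"
  have JL: "J p (lie_bracket U V p) \<in> D p" for p
    using J_in_D[OF L] .
  \<comment> \<open>Smoothness of the vertical part is inherited from \<open>J\<close> of the
    bracket through this equality.\<close>
  have "ver p (J p (lie_bracket U V p)) = J p (lie_bracket U V p)" for p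
    using JL D_subset ver_of_vertical by blast
  then have ?ver
    using JL J_field lie_bracket_field by (simp add: sections_def)
  have hor0: "hor p (J p (lie_bracket U V p)) = 0" for p
    using JL D_subset hor_of_vertical by blast
  \<comment> \<open>The image under \<open>omega\<close> must consist of tangent vectors, since only
    against these is the metric known to vanish at 0.\<close>
  have "0 \<in> mu A g J B F D p" for p
  proof -
    have "D_perp A g B F D p \<subseteq> TM p"
      using Ver_subset by (auto simp: D_perp_def orth_compl_in_def)
    then have "omega A g J B F p ` D_perp A g B F D p \<subseteq> TM p"
      using J_tangent ver_tangent by (auto simp: omega_def hor_eq T_closed subset_iff)
    then show ?thesis
      unfolding mu_def by (intro subspace_0 subspace_orth_compl_in Hor_subspace Hor_subset)
  qed
  moreover have "(\<lambda>p. 0) \<in> vector_fields A"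
    using zero_field[OF lie_bracket_field] by (simp add: zero_fun_def)
  ultimately have ?hor
    by (simp add: sections_def hor0)
  with \<open>?ver\<close> show "?ver \<and> ?hor" ..
next
  assume "?ver \<and> ?hor"
  \<comment> \<open>The bracket is already a smooth vertical field, so only pointwise membership in
    \<open>D\<close> remains.\<close>
  then show "lie_bracket U V \<in> sections A D"
    using in_D_of_J_parts[OF lie_bracket_in_Ver] lie_bracket_field by (simp add: sections_def)
qed

end

end

theorem corollary3p7:
  fixes A :: "('m::{t2_space,second_countable_topology}, 'e::real_normed_vector) atlas"
    and g :: "'m metric"
    and J :: "'m \<Rightarrow> 'm tvec \<Rightarrow> 'm tvec"
    and nabla :: "'m connection"
    and B :: "('b::{t2_space,second_countable_topology}, 'f::real_normed_vector) atlas"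
    and gB :: "'b metric"
    and F :: "'m \<Rightarrow> 'b"
    and D :: "'m \<Rightarrow> 'm tvec set"
  assumes "nearly_kaehler A g J nabla"
    and "riemannian_manifold B gB"
    and "generic_riemannian_submersion A g J B gB F D"
  shows "integrable_distribution A D \<longleftrightarrow>
    (\<forall>U\<in>sections A D. \<forall>V\<in>sections A D.
       vert A g B F (nabla U (phi A g J B F V)) - vert A g B F (nabla V (phi A g J B F U))
         - 2 *\<^sub>R tensor_Q A g J nabla B F U V \<in> sections A D \<and>
       oneill_T A g nabla B F U (phi A g J B F V) - oneill_T A g nabla B F V (phi A g J B F U)
         - 2 *\<^sub>R tensor_P A g J nabla B F U V \<in> sections A (mu A g J B F D))"
proof -
  interpret nearly_kaehler_generic_submersion A g J nabla B gB F D
    using assms by unfold_locales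
  show ?thesis
    unfolding integrable_distribution_def
    using lie_bracket_in_D_iff by (simp add: vertical_expression horizontal_expression)
qed

end
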